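(* Let $\mathcal A$ be an associative unital $\mathbb C$-algebra, $A,B\in\mathcal A$, and $\epsilon,\lambda\in\mathbb C$ nonzero. Then the following are equivalent: (i) $[B,A]=\epsilon(A+B)+\lambda(A+B)^2$; (ii) for all $n\in\mathbb N$, \[ [\lambda]_n(A+B)^n=\sum_{k=0}^n{n\brack k}\epsilon^{n-k}\sum_{j=0}^k\binom{k}{j}A^jB^{k-j}; \] (iii) for all $t$, $e^{At}e^{Bt}=\Big(1+\lambda(A+B)\frac{1-e^{-\epsilon t}}{\epsilon}\Big)^{1/\lambda}$.
   Context: $[X,Y]=XY-YX$; $e^X=\sum_{n\ge0}X^n/n!$. ${n\brack k}$ denotes the unsigned Stirling numbers of the first kind, defined by $x(x-1)\cdots(x-n+1)=\sum_{k=0}^n{n\brack k}(-1)^{n-k}x^k$. $[x]_n:=\prod_{i=1}^{n-1}(1-ix)$ (empty product $=1$). For $X$ a formal series in $t$ with coefficients in $\mathcal A$ and scalar $\mu$, $X^\mu:=\sum_{k\ge0}(X-1)^k\binom{\mu}{k}$ with $\binom{\mu}{k}=\mu(\mu-1)\cdots(\mu-k+1)/k!$. Series are treated formally; identities in $t$ are equalities of formal power series in $t$. *)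

theory Defs
  imports
    Complex_Main
    "HOL-Computational_Algebra.Formal_Power_Series"
    "HOL-Combinatorics.Stirling"
begin

unbundle fps_syntax

class complex_algebra_1 = ring_1 +
  fixes scaleC :: "complex \<Rightarrow> 'a \<Rightarrow> 'a"  (infixr \<open>*\<^sub>C\<close> 75)
  assumes scaleC_add_right: "c *\<^sub>C (x + y) = c *\<^sub>C x + c *\<^sub>C y"
    and scaleC_add_left: "(c + d) *\<^sub>C x = c *\<^sub>C x + d *\<^sub>C x"
    and scaleC_scaleC: "c *\<^sub>C (d *\<^sub>C x) = (c * d) *\<^sub>C x"
    and scaleC_one: "1 *\<^sub>C x = x"
    and mult_scaleC_left: "(c *\<^sub>C x) * y = c *\<^sub>C (x * y)"
    and mult_scaleC_right: "x * (c *\<^sub>C y) = c *\<^sub>C (x * y)"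

global_interpretation scaleC: vector_space "scaleC :: complex \<Rightarrow> 'a \<Rightarrow> 'a::complex_algebra_1"
  by unfold_locales (simp_all add: scaleC_add_right scaleC_add_left scaleC_scaleC scaleC_one)

instantiation fps :: (complex_algebra_1) complex_algebra_1
begin

definition scaleC_fps :: "complex \<Rightarrow> 'a fps \<Rightarrow> 'a fps" where
  "c *\<^sub>C F = Abs_fps (\<lambda>n. c *\<^sub>C (F $ n))"

instance
  by standard
    (simp_all add: scaleC_fps_def fps_eq_iff fps_mult_nth scaleC_add_right scaleC_add_left
      scaleC_scaleC scaleC_one mult_scaleC_left mult_scaleC_right scaleC.scale_sum_right)

end

lemma scaleC_fps_nth [simp]: "(c *\<^sub>C F) $ n = c *\<^sub>C (F $ n)"
  by (simp add: scaleC_fps_def)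

definition commutator :: "'a::ring \<Rightarrow> 'a \<Rightarrow> 'a" where
  "commutator X Y = X * Y - Y * X"

definition bracket_prod :: "complex \<Rightarrow> nat \<Rightarrow> complex" where
  "bracket_prod x n = (\<Prod>i = 1..<n. 1 - of_nat i * x)"

text \<open>The library's recursively defined \<^const>\<open>stirling\<close> satisfies the generating identity that
  defines the unsigned Stirling numbers of the first kind.\<close>

lemma falling_factorial_stirling:
  fixes x :: "'a::comm_ring_1"
  shows "(\<Prod>i<n. x - of_nat i) = (\<Sum>k\<le>n. of_nat (stirling n k) * (-1) ^ (n - k) * x ^ k)"
proof -
  have "(\<Prod>i<n. x - of_nat i) = (\<Prod>i<n. (-1) * (- x + of_nat i))"
    by (intro prod.cong) simp_all
  also have "\<dots> = (-1) ^ n * pochhammer (- x) n"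
    by (subst prod.distrib) (simp add: pochhammer_prod atLeast0LessThan)
  also have "\<dots> = (\<Sum>k\<le>n. (-1) ^ n * (of_nat (stirling n k) * (- x) ^ k))"
    by (simp add: stirling_pochhammer [symmetric] sum_distrib_left)
  also have "\<dots> = (\<Sum>k\<le>n. of_nat (stirling n k) * (-1) ^ (n - k) * x ^ k)"
  proof (intro sum.cong refl)
    fix k assume "k \<in> {..n}"
    then have "(-1 :: 'a) ^ n = (-1) ^ (n - k) * (-1) ^ k"
      by (simp add: power_add [symmetric])
    moreover have "(-1 :: 'a) ^ k * (-1) ^ k = 1"
      by (simp flip: power_mult_distrib)
    ultimately have "(-1 :: 'a) ^ n * (-1) ^ k = (-1) ^ (n - k)"
      by (simp add: mult.assoc)
    moreover have "(-1) ^ n * (of_nat (stirling n k) * (- x) ^ k) =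
        of_nat (stirling n k) * ((-1) ^ n * (-1) ^ k) * x ^ k"
      by (subst power_minus) (simp only: ac_simps)
    ultimately show "(-1) ^ n * (of_nat (stirling n k) * (- x) ^ k) =
        of_nat (stirling n k) * (-1) ^ (n - k) * x ^ k"
      by simp
  qed
  finally show ?thesis .
qed

text \<open>Infinite sums of series are taken in the \<open>t\<close>-adic topology that the library puts on
  \<^typ>\<open>'a fps\<close>; the indeterminate \<open>t\<close> is \<^const>\<open>fps_X\<close> and commutes with all coefficients.  The sums
  below converge when \<open>F\<close> (respectively \<open>F - 1\<close>) has zero constant term.\<close>

definition series_exp :: "'a::complex_algebra_1 fps \<Rightarrow> 'a fps" where
  "series_exp F = (\<Sum>n. (1 / fact n) *\<^sub>C F ^ n)"

definition series_powr :: "'a::complex_algebra_1 fps \<Rightarrow> complex \<Rightarrow> 'a fps" where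
  "series_powr F \<mu> = (\<Sum>k. (\<mu> gchoose k) *\<^sub>C (F - 1) ^ k)"

lemma sums_fps_powers:
  fixes F :: "'a::complex_algebra_1 fps"
  assumes "F $ 0 = 0"
  shows "(\<lambda>k. c k *\<^sub>C F ^ k) sums Abs_fps (\<lambda>n. \<Sum>k\<le>n. c k *\<^sub>C (F ^ k $ n))"
  unfolding sums_def
proof (rule tendsto_fpsI)
  fix n
  show "\<forall>\<^sub>F N in sequentially.
      (\<Sum>k<N. c k *\<^sub>C F ^ k) $ n = Abs_fps (\<lambda>n. \<Sum>k\<le>n. c k *\<^sub>C (F ^ k $ n)) $ n"
    using eventually_gt_at_top [of n]
  proof eventually_elim
    case (elim N)
    have "(\<Sum>k<N. c k *\<^sub>C (F ^ k $ n)) = (\<Sum>k\<le>n. c k *\<^sub>C (F ^ k $ n))"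
      using elim startsby_zero_power_prefix [OF assms]
      by (intro sum.mono_neutral_right) auto
    then show ?case
      by (simp add: fps_sum_nth)
  qed
qed

lemma series_exp_sums:
  "F $ 0 = 0 \<Longrightarrow> (\<lambda>n. (1 / fact n) *\<^sub>C F ^ n) sums series_exp F"
  unfolding series_exp_def by (rule summable_sums, rule sums_summable, rule sums_fps_powers)

lemma series_powr_sums:
  "F $ 0 = 1 \<Longrightarrow> (\<lambda>k. (\<mu> gchoose k) *\<^sub>C (F - 1) ^ k) sums series_powr F \<mu>"
  unfolding series_powr_def
  by (rule summable_sums, rule sums_summable, rule sums_fps_powers) simp

end

theory Submission
  imports Defs
begin

text \<open>Put \<open>X = A + B\<close>, \<open>c\<^sub>n = [\<lambda>]\<^sub>n X\<^sup>n\<close>, \<open>E\<^sub>k = \<Sum>\<^sub>j (k choose j) A\<^sup>j B\<^bsup>k-j\<^esup>\<close> and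
  \<open>L Y = A Y + Y B\<close>, so that \<open>E\<^sub>k = L\<^sup>k 1\<close>.  The relation (i) says \<open>[X, A] = \<epsilon> X + \<lambda> X\<^sup>2\<close>, whence
  \<open>L c\<^sub>n = c\<^bsub>n+1\<^esub> - n \<epsilon> c\<^sub>n\<close>; the right-hand sides of (ii) satisfy the same recurrence.  Conversely,
  (i) is the case \<open>n = 2\<close> of (ii).  With \<open>u = (1 - e\<^bsup>-\<epsilon>t\<^esup>)/\<epsilon>\<close>, (iii) reads
  \<open>\<Sum>\<^sub>m E\<^sub>m t\<^sup>m/m! = \<Sum>\<^sub>k c\<^sub>k u\<^sup>k/k!\<close>.  Since \<open>u' = 1 - \<epsilon> u\<close>, the matrix with entries
  \<open>m! [t\<^sup>m] u\<^sup>k/k!\<close> obeys a recurrence which makes it the inverse of the matrix of (ii).\<close>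

section \<open>Two mutually inverse triangular matrices\<close>

definition stirling_weight :: "complex \<Rightarrow> nat \<Rightarrow> nat \<Rightarrow> complex" where
  "stirling_weight \<epsilon> n k = of_nat (stirling n k) * \<epsilon> ^ (n - k)"

definition exp_param :: "complex \<Rightarrow> complex fps" where
  "exp_param \<epsilon> = fps_const (1 / \<epsilon>) * (1 - fps_exp (- \<epsilon>))"

text \<open>For \<epsilon> \<noteq> 0 this is (-\<epsilon>)^(m-k) S(m,k), with S the Stirling
  numbers of the second kind.\<close>

definition exp_weight :: "complex \<Rightarrow> nat \<Rightarrow> nat \<Rightarrow> complex" where
  "exp_weight \<epsilon> m k = fact m / fact k * (exp_param \<epsilon> ^ k $ m)"

lemma sum_atMost_shift_zero:
  fixes g :: "nat \<Rightarrow> 'a::comm_monoid_add"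
  assumes "g 0 = 0" "g (Suc n) = 0"
  shows "(\<Sum>k\<le>n. g (Suc k)) = (\<Sum>k\<le>n. g k)"
  using sum.atMost_Suc_shift [of g n] assms by simp

text \<open>Summation by parts: a Pascal-type recurrence of the weights becomes an operator acting
  on \<open>f\<close>. The last two premises kill the boundary terms of the index shift. Both
  matrices fit: \<open>a\<close> is constant in \<open>k\<close> for the first and proportional to
  \<open>k\<close> for the second.\<close>

lemma sum_weight_Suc:
  fixes f :: "nat \<Rightarrow> 'a::complex_algebra_1"
  assumes "w' 0 = 0" "\<And>k. w' (Suc k) = w k + a (Suc k) * w (Suc k)"
    and "a 0 * w 0 = 0" "w (Suc n) = 0"
  shows "(\<Sum>k\<le>Suc n. w' k *\<^sub>C f k) = (\<Sum>k\<le>n. w k *\<^sub>C (f (Suc k) + a k *\<^sub>C f k))"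
proof -
  have "(\<Sum>k\<le>Suc n. w' k *\<^sub>C f k) =
      (\<Sum>k\<le>n. w k *\<^sub>C f (Suc k)) + (\<Sum>k\<le>n. (a (Suc k) * w (Suc k)) *\<^sub>C f (Suc k))"
    by (simp add: sum.atMost_Suc_shift assms(1,2) scaleC_add_left sum.distrib del: sum.atMost_Suc)
  also have "(\<Sum>k\<le>n. (a (Suc k) * w (Suc k)) *\<^sub>C f (Suc k)) = (\<Sum>k\<le>n. (a k * w k) *\<^sub>C f k)"
    by (rule sum_atMost_shift_zero) (simp_all add: assms(3,4))
  finally show ?thesis
    by (simp add: scaleC_add_right scaleC_scaleC sum.distrib mult.commute)
qed

lemma sum_stirling_weight_Suc:
  fixes f :: "nat \<Rightarrow> 'a::complex_algebra_1"
  shows "(\<Sum>k\<le>Suc n. stirling_weight \<epsilon> (Suc n) k *\<^sub>C f k) =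
    (\<Sum>k\<le>n. stirling_weight \<epsilon> n k *\<^sub>C (f (Suc k) + (of_nat n * \<epsilon>) *\<^sub>C f k))"
proof (rule sum_weight_Suc)
  show "stirling_weight \<epsilon> (Suc n) (Suc k) =
      stirling_weight \<epsilon> n k + of_nat n * \<epsilon> * stirling_weight \<epsilon> n (Suc k)" for k
  \<comment> \<open>Subtraction is truncated: for \<open>k\<close> \<ge> \<open>n\<close> the
    exponents do not match, but \<open>stirling n (Suc k)\<close> vanishes.\<close>
  proof (cases "k < n")
    case True
    then have "n - k = Suc (n - Suc k)" by simp
    then show ?thesis by (simp add: stirling_weight_def algebra_simps)
  qed (simp add: stirling_weight_def)
  show "of_nat n * \<epsilon> * stirling_weight \<epsilon> n 0 = 0"
    by (cases n) (simp_all add: stirling_weight_def)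
qed (simp_all add: stirling_weight_def)

lemma exp_param_nth_0 [simp]: "exp_param \<epsilon> $ 0 = 0"
  by (simp add: exp_param_def)

lemma deriv_exp_param:
  assumes "\<epsilon> \<noteq> 0"
  shows "fps_deriv (exp_param \<epsilon>) = 1 - fps_const \<epsilon> * exp_param \<epsilon>"
  using assms by (simp add: exp_param_def fps_eq_iff)

text \<open>Compare coefficients of t^m in (u^(k+1))' = (k+1)(u^k - \<epsilon> u^(k+1)), which
  follows from u' = 1 - \<epsilon> u.\<close>

lemma exp_weight_Suc:
  assumes "\<epsilon> \<noteq> 0"
  shows "exp_weight \<epsilon> (Suc m) (Suc k) =
    exp_weight \<epsilon> m k - \<epsilon> * of_nat (Suc k) * exp_weight \<epsilon> m (Suc k)"
proof -
  have "fps_deriv (exp_param \<epsilon> ^ Suc k) =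
      of_nat (Suc k) * (exp_param \<epsilon> ^ k - fps_const \<epsilon> * exp_param \<epsilon> ^ Suc k)"
    by (simp only: fps_deriv_power deriv_exp_param [OF assms] fps_of_nat diff_Suc_1)
      (simp add: algebra_simps)
  from arg_cong [OF this, of "\<lambda>f. f $ m"]
  have "of_nat (Suc m) * (exp_param \<epsilon> ^ Suc k $ Suc m) =
      of_nat (Suc k) * (exp_param \<epsilon> ^ k $ m - \<epsilon> * (exp_param \<epsilon> ^ Suc k $ m))"
    by (simp add: fps_mult_of_nat_nth del: power_Suc of_nat_Suc)
  then have "exp_weight \<epsilon> (Suc m) (Suc k) = fact m / fact (Suc k) *
      (of_nat (Suc k) * (exp_param \<epsilon> ^ k $ m - \<epsilon> * (exp_param \<epsilon> ^ Suc k $ m)))"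
    unfolding exp_weight_def fact_Suc [of m] by (simp add: mult_ac del: power_Suc of_nat_Suc)
  then show ?thesis
    unfolding exp_weight_def fact_Suc [of k]
    by (simp add: field_simps del: power_Suc of_nat_Suc)
qed

lemma sum_exp_weight_Suc:
  fixes f :: "nat \<Rightarrow> 'a::complex_algebra_1"
  assumes "\<epsilon> \<noteq> 0"
  shows "(\<Sum>k\<le>Suc m. exp_weight \<epsilon> (Suc m) k *\<^sub>C f k) =
    (\<Sum>k\<le>m. exp_weight \<epsilon> m k *\<^sub>C (f (Suc k) + (- \<epsilon> * of_nat k) *\<^sub>C f k))"
proof (rule sum_weight_Suc)
  show "exp_weight \<epsilon> m (Suc m) = 0"
    using startsby_zero_power_prefix [of "exp_param \<epsilon>" "Suc m"] by (simp add: exp_weight_def)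
qed (simp_all add: exp_weight_Suc [OF assms], simp add: exp_weight_def)

text \<open>The recurrences change \<open>f\<close>, so the induction keeps it arbitrary. For the
  sequence f(l+1) - \<epsilon> l f(l) the hypothesis gives f(n+1) - \<epsilon> n f(n); the extra
  term n \<epsilon> f(n) of the Stirling recurrence cancels the surplus.\<close>

lemma stirling_exp_weight_inverse:
  fixes f :: "nat \<Rightarrow> 'a::complex_algebra_1"
  assumes "\<epsilon> \<noteq> 0"
  shows "(\<Sum>k\<le>n. stirling_weight \<epsilon> n k *\<^sub>C (\<Sum>l\<le>k. exp_weight \<epsilon> k l *\<^sub>C f l)) = f n"
proof (induction n arbitrary: f)
  case 0
  show ?case by (simp add: stirling_weight_def exp_weight_def scaleC_one)
next
  case (Suc n)
  show ?case
    unfolding sum_stirling_weight_Suc sum_exp_weight_Suc [OF assms]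
    by (simp only: scaleC_add_right [of _ "sum _ _"] sum.distrib Suc.IH
          scaleC.scale_left_commute [of _ "of_nat n * \<epsilon>"] scaleC.scale_sum_right [symmetric])
      (simp add: mult.commute)
qed

lemma exp_stirling_weight_inverse:
  fixes f :: "nat \<Rightarrow> 'a::complex_algebra_1"
  assumes "\<epsilon> \<noteq> 0"
  shows "(\<Sum>k\<le>n. exp_weight \<epsilon> n k *\<^sub>C (\<Sum>l\<le>k. stirling_weight \<epsilon> k l *\<^sub>C f l)) = f n"
proof (induction n arbitrary: f)
  case 0
  show ?case by (simp add: stirling_weight_def exp_weight_def scaleC_one)
next
  case (Suc n)
  \<comment> \<open>In this order the terms k \<epsilon> and -\<epsilon> k cancel within each row,
    so the hypothesis is applied to the shifted sequence alone.\<close>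
  have "(\<Sum>l\<le>k. stirling_weight \<epsilon> k l *\<^sub>C (f (Suc l) + (of_nat k * \<epsilon>) *\<^sub>C f l)) +
      (- \<epsilon> * of_nat k) *\<^sub>C (\<Sum>l\<le>k. stirling_weight \<epsilon> k l *\<^sub>C f l) =
      (\<Sum>l\<le>k. stirling_weight \<epsilon> k l *\<^sub>C f (Suc l))" for k
    by (simp add: scaleC_add_right sum.distrib scaleC.scale_sum_right scaleC_scaleC mult_ac)
      (simp add: sum_negf)
  then show ?case
    unfolding sum_exp_weight_Suc [OF assms] sum_stirling_weight_Suc by (simp only: Suc.IH)
qed

section \<open>The binomial sums\<close>

definition ordered_binomial :: "'a::complex_algebra_1 \<Rightarrow> 'a \<Rightarrow> nat \<Rightarrow> 'a" where
  "ordered_binomial A B k = (\<Sum>j = 0..k. of_nat (k choose j) * A ^ j * B ^ (k - j))"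

lemma of_nat_eq_scaleC: "of_nat n = of_nat n *\<^sub>C (1 :: 'a::complex_algebra_1)"
  by (induction n) (simp_all add: scaleC_add_left scaleC_one)

text \<open>Writing the binomial as a quotient of factorials exhibits k! times the Cauchy product
  for the coefficient of t^k in e^(At) e^(Bt).\<close>

lemma ordered_binomial_eq:
  "ordered_binomial A B k = fact k *\<^sub>C
    (\<Sum>j = 0..k. ((1 / fact j) *\<^sub>C A ^ j) * ((1 / fact (k - j)) *\<^sub>C B ^ (k - j)))"
  unfolding ordered_binomial_def scaleC.scale_sum_right
proof (rule sum.cong)
  fix j assume "j \<in> {0..k}"
  then have "of_nat (k choose j) = (fact k / (fact j * fact (k - j)) :: complex)"
    by (simp add: binomial_fact)
  then show "of_nat (k choose j) * A ^ j * B ^ (k - j) =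
      fact k *\<^sub>C (((1 / fact j) *\<^sub>C A ^ j) * ((1 / fact (k - j)) *\<^sub>C B ^ (k - j)))"
    by (simp add: of_nat_eq_scaleC mult_scaleC_left mult_scaleC_right scaleC_scaleC mult.assoc)
qed simp

text \<open>Pascal's rule: one part gains a factor A on the far left, the other a factor B on the
  far right, so A and B never have to be interchanged.\<close>

lemma ordered_binomial_Suc:
  "ordered_binomial A B (Suc k) = A * ordered_binomial A B k + ordered_binomial A B k * B"
proof -
  have "ordered_binomial A B (Suc k) =
      B ^ Suc k + (\<Sum>j\<le>k. of_nat (Suc k choose Suc j) * A ^ Suc j * B ^ (k - j))"
    by (simp add: ordered_binomial_def atLeast0AtMost sum.atMost_Suc_shift del: sum.atMost_Suc
        binomial_Suc_Suc)
  also have "\<dots> = (\<Sum>j\<le>k. of_nat (k choose j) * A ^ Suc j * B ^ (k - j)) +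
      (B ^ Suc k + (\<Sum>j\<le>k. of_nat (k choose Suc j) * A ^ Suc j * B ^ (Suc k - Suc j)))"
    by (simp add: algebra_simps sum.distrib)
  also have "B ^ Suc k + (\<Sum>j\<le>k. of_nat (k choose Suc j) * A ^ Suc j * B ^ (Suc k - Suc j)) =
      (\<Sum>j\<le>Suc k. of_nat (k choose j) * A ^ j * B ^ (Suc k - j))"
    by (subst sum.atMost_Suc_shift) simp
  also have "\<dots> = (\<Sum>j\<le>k. of_nat (k choose j) * A ^ j * B ^ (k - j)) * B"
    by (simp add: sum_distrib_right Suc_diff_le mult.assoc binomial_eq_0 flip: power_Suc2)
  also have "(\<Sum>j\<le>k. of_nat (k choose j) * A ^ Suc j * B ^ (k - j)) =
      A * (\<Sum>j\<le>k. of_nat (k choose j) * A ^ j * B ^ (k - j))"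
    unfolding sum_distrib_left
    by (rule sum.cong) (simp_all add: mult_of_nat_commute [of _ A] flip: mult.assoc)
  finally show ?thesis
    by (simp add: ordered_binomial_def atLeast0AtMost)
qed

section \<open>The commutation relation\<close>

lemma bracket_prod_Suc: "bracket_prod x (Suc n) = bracket_prod x n * (1 - of_nat n * x)"
  by (cases n) (simp_all add: bracket_prod_def)

text \<open>The commutator [X, A] is a polynomial in X, hence commutes with X, and each of the n
  passages of A contributes the same term.\<close>

lemma commutator_power:
  fixes A X :: "'a::complex_algebra_1"
  assumes "commutator X A = \<epsilon> *\<^sub>C X + lam *\<^sub>C X ^ 2"
  shows "X ^ n * A = A * X ^ n + of_nat n *\<^sub>C (\<epsilon> *\<^sub>C X ^ n + lam *\<^sub>C X ^ Suc n)"
proof (induction n)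
  case 0
  show ?case by simp
next
  case (Suc n)
  have XA: "X * A = A * X + (\<epsilon> *\<^sub>C X + lam *\<^sub>C X ^ 2)"
    using assms by (simp add: commutator_def algebra_simps)
  have "X ^ Suc n * A = X * (X ^ n * A)"
    by (simp add: mult.assoc)
  also have "\<dots> = (X * A) * X ^ n + of_nat n *\<^sub>C (\<epsilon> *\<^sub>C X ^ Suc n + lam *\<^sub>C X ^ Suc (Suc n))"
    by (simp add: Suc.IH distrib_left mult_scaleC_right mult.assoc)
  also have "(X * A) * X ^ n = A * X ^ Suc n + (\<epsilon> *\<^sub>C X ^ Suc n + lam *\<^sub>C X ^ Suc (Suc n))"
    by (simp add: XA distrib_right mult_scaleC_left mult.assoc power2_eq_square)
  finally show ?case
    by (simp add: scaleC_add_left scaleC_one add_ac)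
qed

lemma bracket_power_Suc:
  fixes A B :: "'a::complex_algebra_1"
  assumes "commutator B A = \<epsilon> *\<^sub>C (A + B) + lam *\<^sub>C (A + B) ^ 2"
  defines "c \<equiv> \<lambda>n. bracket_prod lam n *\<^sub>C (A + B) ^ n"
  shows "c (Suc n) = A * c n + c n * B + (of_nat n * \<epsilon>) *\<^sub>C c n"
proof -
  define X where "X = A + B"
  \<comment> \<open>[A, A] = 0, so X and B have the same commutator with A.\<close>
  have "commutator X A = \<epsilon> *\<^sub>C X + lam *\<^sub>C X ^ 2"
    using assms(1) by (simp add: commutator_def X_def algebra_simps)
  from commutator_power [OF this, of n]
  \<comment> \<open>Trading A X^n for X^n A completes X^n B to X^(n+1); the \<epsilon>-terms cancel,
    and what is left is the new factor 1 - n \<open>lam\<close> of the bracket product.\<close>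
  have "A * X ^ n + X ^ n * B + (of_nat n * \<epsilon>) *\<^sub>C X ^ n =
      X ^ n * (A + B) - (of_nat n * lam) *\<^sub>C X ^ Suc n"
    by (simp add: distrib_left scaleC_add_right scaleC_scaleC algebra_simps)
  also have "\<dots> = (1 - of_nat n * lam) *\<^sub>C X ^ Suc n"
    by (simp add: X_def [symmetric] power_Suc2 scaleC.scale_left_diff_distrib scaleC_one
        del: power_Suc)
  finally have "bracket_prod lam n *\<^sub>C (A * X ^ n + X ^ n * B + (of_nat n * \<epsilon>) *\<^sub>C X ^ n) = c (Suc n)"
    by (simp add: c_def bracket_prod_Suc scaleC_scaleC X_def)
  then show ?thesis
    by (simp add: c_def X_def scaleC_add_right mult_scaleC_left mult_scaleC_right scaleC_scaleC
        mult_ac)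
qed

lemma commutator_iff_stirling:
  fixes A B :: "'a::complex_algebra_1"
  shows "commutator B A = \<epsilon> *\<^sub>C (A + B) + lam *\<^sub>C (A + B) ^ 2 \<longleftrightarrow>
    (\<forall>n. bracket_prod lam n *\<^sub>C (A + B) ^ n =
      (\<Sum>k\<le>n. stirling_weight \<epsilon> n k *\<^sub>C ordered_binomial A B k))"
    (is "?comm \<longleftrightarrow> (\<forall>n. ?c n = ?d n)")
proof
  assume comm: ?comm
  have "?c n = ?d n" for n
  proof (induction n)
    case 0
    show ?case by (simp add: bracket_prod_def stirling_weight_def ordered_binomial_def)
  next
    case (Suc n)
    have "?d (Suc n) = A * ?d n + ?d n * B + (of_nat n * \<epsilon>) *\<^sub>C ?d n"
      by (simp only: sum_stirling_weight_Suc ordered_binomial_Suc scaleC_add_right sum.distrib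
          sum_distrib_left sum_distrib_right mult_scaleC_left mult_scaleC_right
          scaleC.scale_sum_right scaleC.scale_left_commute [of _ "of_nat n * \<epsilon>"])
    then show ?case
      by (simp only: bracket_power_Suc [OF comm] Suc.IH)
  qed
  then show "\<forall>n. ?c n = ?d n" by blast
next
  assume "\<forall>n. ?c n = ?d n"
  then have "?c 2 = ?d 2" by blast
  \<comment> \<open>For X = A + B, subtracting A X + X B from X^2 leaves B X - X B, which is
    [B, A].\<close>
  then have "(1 - lam) *\<^sub>C (A + B) ^ 2 = \<epsilon> *\<^sub>C (A + B) + (A * (A + B) + (A + B) * B)"
    by (simp add: bracket_prod_def stirling_weight_def ordered_binomial_Suc numeral_2_eq_2
        scaleC_one ordered_binomial_def [of _ _ 0])
  then show ?comm
    by (simp add: commutator_def scaleC.scale_left_diff_distrib scaleC_one power2_eq_square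
        algebra_simps)
qed

section \<open>Coefficients of the series\<close>

lemma series_exp_nth:
  assumes "F $ 0 = 0"
  shows "series_exp F $ n = (\<Sum>k\<le>n. (1 / fact k) *\<^sub>C (F ^ k $ n))"
  unfolding series_exp_def by (subst sums_unique [OF sums_fps_powers [OF assms], symmetric]) simp

lemma series_powr_nth:
  assumes "F $ 0 = 1"
  shows "series_powr F \<mu> $ n = (\<Sum>k\<le>n. (\<mu> gchoose k) *\<^sub>C ((F - 1) ^ k $ n))"
  unfolding series_powr_def
  by (subst sums_unique [OF sums_fps_powers, symmetric]) (simp_all add: assms)

lemma const_times_X_power:
  "(fps_const a * fps_X) ^ k = fps_const (a ^ k) * (fps_X :: 'a::ring_1 fps) ^ k"
proof (induction k)
  case (Suc k)
  then show ?case
    by (metis (no_types) fps_const_mult fps_mult_fps_X_commute mult.assoc power_Suc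
        fps_mult_fps_X_power_commute)
qed simp

lemma series_exp_const_times_X_nth:
  "series_exp (fps_const a * fps_X) $ n = (1 / fact n) *\<^sub>C a ^ n"
  by (simp add: series_exp_nth const_times_X_power if_distrib sum.delta cong: if_cong)

lemma series_exp_scaleC_X_nth:
  "series_exp (c *\<^sub>C fps_X) $ n = (fps_exp c $ n) *\<^sub>C (1 :: 'a::complex_algebra_1)"
proof -
  have "c *\<^sub>C fps_X = fps_const (c *\<^sub>C (1::'a)) * fps_X"
    by (simp add: fps_eq_iff)
  moreover have "(c *\<^sub>C (1::'a)) ^ n = c ^ n *\<^sub>C 1"
    by (induction n) (simp_all add: scaleC_one mult_scaleC_left scaleC_scaleC)
  ultimately show ?thesis
    by (simp add: series_exp_const_times_X_nth scaleC_scaleC)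
qed

text \<open>Such a series is a scalar series times the single element \<open>x\<close>, so its
  powers behave as in a commutative ring.\<close>

lemma scalar_fps_power_nth:
  fixes x :: "'a::complex_algebra_1" and u :: "complex fps"
  assumes "\<And>n. F $ n = (u $ n) *\<^sub>C x"
  shows "F ^ k $ n = (u ^ k $ n) *\<^sub>C x ^ k"
  by (induction k arbitrary: n)
    (simp_all add: assms fps_mult_nth scaleC_one mult_scaleC_left mult_scaleC_right
      scaleC_scaleC scaleC.scale_sum_left mult.commute)

text \<open>Each factor 1/\<open>lam\<close> - i of the falling factorial, times \<open>lam\<close>,
  becomes 1 - i \<open>lam\<close>; the factor for i = 0 becomes 1.\<close>

lemma gchoose_inverse_eq:
  assumes "lam \<noteq> 0"
  shows "((1 / lam) gchoose k) * lam ^ k = bracket_prod lam k / fact k"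
proof (induction k)
  case 0
  show ?case by (simp add: bracket_prod_def)
next
  case (Suc k)
  have "((1 / lam) gchoose Suc k) * lam ^ Suc k =
      (((1 / lam) gchoose k) * lam ^ k) * (1 - of_nat k * lam) / of_nat (Suc k)"
    using arg_cong [OF gbinomial_mult_1 [of "1 / lam" k], of "\<lambda>z. lam ^ Suc k * z"] assms
    by (simp add: field_simps del: of_nat_Suc)
  then show ?case
    by (simp add: Suc.IH bracket_prod_Suc)
qed

lemma series_exp_product_nth:
  "fact m *\<^sub>C ((series_exp (fps_const A * fps_X) * series_exp (fps_const B * fps_X)) $ m) =
    ordered_binomial A B m"
  by (simp add: fps_mult_nth series_exp_const_times_X_nth ordered_binomial_eq)

lemma series_powr_exp_param_nth:
  fixes x :: "'a::complex_algebra_1"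
  assumes "lam \<noteq> 0"
  shows "fact m *\<^sub>C (series_powr
      (1 + lam *\<^sub>C (fps_const x * ((1 / \<epsilon>) *\<^sub>C (1 - series_exp ((- \<epsilon>) *\<^sub>C fps_X))))) (1 / lam) $ m) =
    (\<Sum>k\<le>m. exp_weight \<epsilon> m k *\<^sub>C (bracket_prod lam k *\<^sub>C x ^ k))"
proof -
  define U :: "'a fps" where "U = (1 / \<epsilon>) *\<^sub>C (1 - series_exp ((- \<epsilon>) *\<^sub>C fps_X))"
  define F where "F = fps_const x * U"
  have F: "(lam *\<^sub>C F) $ n = (exp_param \<epsilon> $ n) *\<^sub>C (lam *\<^sub>C x)" for n
  proof -
    have "U $ n = (exp_param \<epsilon> $ n) *\<^sub>C 1"
      \<comment> \<open>The leading 1 in 1 - e^(-\<epsilon>t) affects only the constant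
        term.\<close>
      by (cases "n = 0") (simp_all add: U_def exp_param_def series_exp_scaleC_X_nth scaleC_scaleC
          scaleC_one flip: scaleC.scale_minus_left)
    then show ?thesis
      by (simp add: F_def mult_scaleC_right scaleC_scaleC mult.commute)
  qed
  have pow: "(lam *\<^sub>C x) ^ k = lam ^ k *\<^sub>C x ^ k" for k
    by (induction k) (simp_all add: scaleC_one mult_scaleC_left mult_scaleC_right scaleC_scaleC
        mult.commute)
  have "fact m *\<^sub>C (series_powr (1 + lam *\<^sub>C F) (1 / lam) $ m) =
      (\<Sum>k\<le>m. fact m *\<^sub>C (((1 / lam) gchoose k) *\<^sub>C ((lam *\<^sub>C F) ^ k $ m)))"
    \<comment> \<open>The zero constant term of \<open>lam *\<^sub>C F\<close> gives the base of the
      power constant term 1 and truncates the binomial series at \<open>m\<close>.\<close>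
    using F [of 0] by (subst series_powr_nth) (simp_all add: scaleC.scale_sum_right)
  also have "\<dots> = (\<Sum>k\<le>m. exp_weight \<epsilon> m k *\<^sub>C (bracket_prod lam k *\<^sub>C x ^ k))"
  proof (rule sum.cong)
    fix k
    have "fact m *\<^sub>C (((1 / lam) gchoose k) *\<^sub>C ((lam *\<^sub>C F) ^ k $ m)) =
        (fact m * (exp_param \<epsilon> ^ k $ m) * (((1 / lam) gchoose k) * lam ^ k)) *\<^sub>C x ^ k"
      by (simp add: scalar_fps_power_nth [OF F] pow scaleC_scaleC mult_ac)
    then show "fact m *\<^sub>C (((1 / lam) gchoose k) *\<^sub>C ((lam *\<^sub>C F) ^ k $ m)) =
        exp_weight \<epsilon> m k *\<^sub>C (bracket_prod lam k *\<^sub>C x ^ k)"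
      by (simp add: gchoose_inverse_eq [OF assms] exp_weight_def scaleC_scaleC)
  qed simp
  finally show ?thesis unfolding F_def U_def .
qed

theorem theorem4p1:
  fixes A B :: "'a::complex_algebra_1" and \<epsilon> lam :: complex
  assumes "\<epsilon> \<noteq> 0" and "lam \<noteq> 0"
  shows "(commutator B A = \<epsilon> *\<^sub>C (A + B) + lam *\<^sub>C (A + B) ^ 2
           \<longleftrightarrow>
          (\<forall>n::nat. bracket_prod lam n *\<^sub>C (A + B) ^ n =
             (\<Sum>k = 0..n. (of_nat (stirling n k) * \<epsilon> ^ (n - k)) *\<^sub>C
               (\<Sum>j = 0..k. of_nat (k choose j) * A ^ j * B ^ (k - j)))))
         \<and>
         ((\<forall>n::nat. bracket_prod lam n *\<^sub>C (A + B) ^ n =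
             (\<Sum>k = 0..n. (of_nat (stirling n k) * \<epsilon> ^ (n - k)) *\<^sub>C
               (\<Sum>j = 0..k. of_nat (k choose j) * A ^ j * B ^ (k - j))))
           \<longleftrightarrow>
          series_exp (fps_const A * fps_X) * series_exp (fps_const B * fps_X) =
            series_powr
              (1 + lam *\<^sub>C (fps_const (A + B) *
                 ((1 / \<epsilon>) *\<^sub>C (1 - series_exp ((- \<epsilon>) *\<^sub>C fps_X)))))
              (1 / lam))"
    (is "(?comm \<longleftrightarrow> ?ii) \<and> (?ii \<longleftrightarrow> ?P = ?Q)")
proof -
  let ?c = "\<lambda>n. bracket_prod lam n *\<^sub>C (A + B) ^ n"
  have ii: "?ii \<longleftrightarrow> (\<forall>n. ?c n = (\<Sum>k\<le>n. stirling_weight \<epsilon> n k *\<^sub>C ordered_binomial A B k))"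
    by (simp only: stirling_weight_def ordered_binomial_def atLeast0AtMost)
  \<comment> \<open>Scaling by m! is injective and turns the coefficients into the two sides of a
    matrix identity.\<close>
  have "?P = ?Q \<longleftrightarrow> (\<forall>m. fact m *\<^sub>C (?P $ m) = fact m *\<^sub>C (?Q $ m))"
    by (simp add: fps_eq_iff)
  also have "\<dots> \<longleftrightarrow> (\<forall>m. ordered_binomial A B m = (\<Sum>k\<le>m. exp_weight \<epsilon> m k *\<^sub>C ?c k))"
    by (simp only: series_exp_product_nth series_powr_exp_param_nth [OF assms(2)])
  \<comment> \<open>One identity applies the exponential matrix to the sequence \<open>?c\<close>,
    the other the Stirling matrix to the binomial sums; each inverts the other.\<close>
  also have "\<dots> \<longleftrightarrow> ?ii"
    unfolding ii
  proof (intro iffI allI)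
    fix n assume "\<forall>m. ordered_binomial A B m = (\<Sum>k\<le>m. exp_weight \<epsilon> m k *\<^sub>C ?c k)"
    then show "?c n = (\<Sum>k\<le>n. stirling_weight \<epsilon> n k *\<^sub>C ordered_binomial A B k)"
      by (simp only: stirling_exp_weight_inverse [OF assms(1)])
  next
    fix m assume "\<forall>n. ?c n = (\<Sum>k\<le>n. stirling_weight \<epsilon> n k *\<^sub>C ordered_binomial A B k)"
    then show "ordered_binomial A B m = (\<Sum>k\<le>m. exp_weight \<epsilon> m k *\<^sub>C ?c k)"
      by (simp only: exp_stirling_weight_inverse [OF assms(1)])
  qed
  finally show ?thesis
    using ii commutator_iff_stirling by blast
qed

end
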